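(* Let $K\ge 0$, let $L\ge 2$ be an integer, and let $\Lambda\subset\mathbb{Z}$ be a finite set containing $\{1,\dots,L\}$. Let $\alpha=(\alpha_x)_{x\in\Lambda}$ be an external field with $\alpha_x\in[-K,K]$ for all $x\in\Lambda$, let $0\le N\le|\Lambda|$ be an integer, and let $\mu=\mu_{\alpha,\Lambda,N}$ be the inhomogeneous Bernoulli measure on $\{0,1\}^\Lambda$ with field $\alpha$ conditioned to have exactly $N$ particles. Then for every function $f:\{0,1\}^\Lambda\to\mathbb{R}$, $$E_\mu\big[(f(T_{1,L}\eta)-f(\eta))^2\big]\le e^{13K}\,L\sum_{1\le x\le L-1}E_\mu\big[(f(T_{x,x+1}\eta)-f(\eta))^2\big].$$
   Context: For a finite set $\Lambda$ and a field $(\alpha_x)_{x\in\Lambda}$, put $p_x=e^{\alpha_x}/(1+e^{\alpha_x})$. The inhomogeneous Bernoulli measure on configurations $\eta=(\eta_x)_{x\in\Lambda}\in\{0,1\}^\Lambda$ is the product probability measure $\mu_{\alpha,\Lambda}(\eta)=\prod_{x\in\Lambda}p_x^{\eta_x}(1-p_x)^{1-\eta_x}$. Conditioned to have $N$ particles it is $\mu_{\alpha,\Lambda,N}(\eta)=\mu_{\alpha,\Lambda}(\eta\mid\sum_{x\in\Lambda}\eta_x=N)$; that is, $\mu_{\alpha,\Lambda,N}(\eta)$ is proportional to $\exp\{\sum_{x\in\Lambda}\alpha_x\eta_x\}$ on configurations with exactly $N$ particles and is zero on all others. $E_\mu$ denotes expectation with respect to $\mu$. For $x,y\in\Lambda$,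 $T_{x,y}\eta$ is the configuration obtained from $\eta$ by exchanging the values at $x$ and $y$: $(T_{x,y}\eta)_x=\eta_y$, $(T_{x,y}\eta)_y=\eta_x$, and $(T_{x,y}\eta)_z=\eta_z$ for $z\ne x,y$. *)

theory Defs
  imports "HOL-Probability.Product_PMF"
begin

text \<open>
  A configuration on a finite set \<open>\<Lambda>\<close> of sites is a total function to \<^typ>\<open>bool\<close> (\<^term>\<open>True\<close> meaning
  that the site is occupied). The measures below are supported on functions that are \<^term>\<open>False\<close>
  outside \<open>\<Lambda>\<close>; these correspond bijectively to \<open>{0,1}\<^sup>\<Lambda>\<close>.
\<close>

definition density :: "real \<Rightarrow> real" where
  "density a = exp a / (1 + exp a)"

definition inhom_bernoulli :: "('a \<Rightarrow> real) \<Rightarrow> 'a set \<Rightarrow> ('a \<Rightarrow> bool) pmf" where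
  "inhom_bernoulli \<alpha> \<Lambda> = Pi_pmf \<Lambda> False (\<lambda>x. bernoulli_pmf (density (\<alpha> x)))"

definition particle_number :: "'a set \<Rightarrow> ('a \<Rightarrow> bool) \<Rightarrow> nat" where
  "particle_number \<Lambda> \<eta> = (\<Sum>x\<in>\<Lambda>. of_bool (\<eta> x))"

text \<open>
  \<^const>\<open>cond_pmf\<close> is specified only when the conditioning event has positive probability; by
  \<open>inhom_bernoulli_particle_number_possible\<close> below this is the case for \<open>N \<le> card \<Lambda>\<close>.
\<close>

definition cond_bernoulli :: "('a \<Rightarrow> real) \<Rightarrow> 'a set \<Rightarrow> nat \<Rightarrow> ('a \<Rightarrow> bool) pmf" where
  "cond_bernoulli \<alpha> \<Lambda> N = cond_pmf (inhom_bernoulli \<alpha> \<Lambda>) {\<eta>. particle_number \<Lambda> \<eta> = N}"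

definition exchange :: "'a \<Rightarrow> 'a \<Rightarrow> ('a \<Rightarrow> 'b) \<Rightarrow> 'a \<Rightarrow> 'b" where
  "exchange x y \<eta> = \<eta>(x := \<eta> y, y := \<eta> x)"

lemma density_bounds: "0 < density a" "density a < 1"
  by (simp_all add: density_def field_simps add_pos_pos)

lemma pmf_inhom_bernoulli:
  assumes "finite \<Lambda>" and "\<And>x. x \<notin> \<Lambda> \<Longrightarrow> \<not> \<eta> x"
  shows "pmf (inhom_bernoulli \<alpha> \<Lambda>) \<eta> =
    (\<Prod>x\<in>\<Lambda>. density (\<alpha> x) ^ of_bool (\<eta> x) * (1 - density (\<alpha> x)) ^ (1 - of_bool (\<eta> x)))"
proof -
  have "pmf (bernoulli_pmf (density a)) b = density a ^ of_bool b * (1 - density a) ^ (1 - of_bool b)"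
    for a b
    using density_bounds[of a] by (cases b) auto
  then show ?thesis
    unfolding inhom_bernoulli_def using assms by (subst pmf_Pi') auto
qed

lemma set_pmf_inhom_bernoulli:
  assumes "finite \<Lambda>"
  shows "set_pmf (inhom_bernoulli \<alpha> \<Lambda>) = {\<eta>. \<forall>x. x \<notin> \<Lambda> \<longrightarrow> \<not> \<eta> x}"
proof -
  have "set_pmf (bernoulli_pmf (density a)) = UNIV" for a
    using density_bounds[of a] by (simp add: set_pmf_bernoulli)
  then show ?thesis
    using assms by (auto simp: inhom_bernoulli_def set_Pi_pmf PiE_dflt_def)
qed

lemma inhom_bernoulli_particle_number_possible:
  assumes "finite \<Lambda>" and "N \<le> card \<Lambda>"
  shows "set_pmf (inhom_bernoulli \<alpha> \<Lambda>) \<inter> {\<eta>. particle_number \<Lambda> \<eta> = N} \<noteq> {}"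
proof -
  obtain A where A: "A \<subseteq> \<Lambda>" "card A = N"
    using obtain_subset_with_card_n[OF assms(2)] by blast
  have "particle_number \<Lambda> (\<lambda>x. x \<in> A) = N"
    using A assms(1) by (simp add: particle_number_def of_bool_def sum.If_cases Int_absorb1)
  moreover have "(\<lambda>x. x \<in> A) \<in> set_pmf (inhom_bernoulli \<alpha> \<Lambda>)"
    using A assms(1) by (auto simp: set_pmf_inhom_bernoulli)
  ultimately show ?thesis by blast
qed

end

theory Submission
  imports Defs
begin

text \<open>
  A jump of a particle from \<open>x\<close> to \<open>y\<close> factors through any intermediate site \<open>m\<close> into one jump along
  \<open>{x, m}\<close> and one along \<open>{m, y}\<close>, so Dirichlet forms behave like resistances in series. With an
  external field each such step could cost a factor \<open>exp (2 * K)\<close>. To avoid losing it at every level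
  of the recursion, the jump rate along \<open>{x, y}\<close> is tilted to be proportional to
  \<open>exp (\<alpha> x + \<alpha> y)\<close>, relative to the weight of the configuration off \<open>{x, y}\<close>. The series law then
  holds without any loss as long as the field at \<open>m\<close> is at least that at \<open>x\<close> and \<open>y\<close>. Replacing the
  field at \<open>1\<close> and \<open>L\<close> by \<open>- K\<close> in the tilt (the function \<open>b\<close> below) and always splitting an interval
  at an interior minimum of the field keeps this condition true down to nearest neighbours, and
  only comparing the tilted rates with the true ones costs a factor, namely \<open>exp (4 * K)\<close>.
\<close>

section \<open>Elementary facts on exchanges and squares\<close>

lemma exchange_simps [simp]:
  "exchange x y \<eta> x = \<eta> y" "exchange x y \<eta> y = \<eta> x"
  "z \<noteq> x \<Longrightarrow> z \<noteq> y \<Longrightarrow> exchange x y \<eta> z = \<eta> z"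
  by (auto simp: exchange_def)

lemma exchange_exchange [simp]: "exchange x y (exchange x y \<eta>) = \<eta>"
  by (auto simp: exchange_def)

lemma exchange_eq_self: "\<eta> x = \<eta> y \<Longrightarrow> exchange x y \<eta> = \<eta>"
  by (auto simp: exchange_def)

lemma exchange_eq_comp_transpose: "exchange x y \<eta> = \<eta> \<circ> Transposition.transpose x y"
  by (auto simp: exchange_def fun_eq_iff Transposition.transpose_def)

text \<open>Cauchy-Schwarz with two weights; the gap is a single square over \<open>s * t\<close>.
  The weights stay free so that they can become the lengths of two subintervals.\<close>

lemma square_add_le_weighted:
  fixes s t u v :: real
  assumes "s > 0" "t > 0"
  shows "(u + v)\<^sup>2 \<le> (s + t) * (u\<^sup>2 / s + v\<^sup>2 / t)"
proof -
  have "(s + t) * (u\<^sup>2 / s + v\<^sup>2 / t) - (u + v)\<^sup>2 = (t * u - s * v)\<^sup>2 / (s * t)"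
    using assms by (simp add: field_simps power2_eq_square)
  moreover have "(t * u - s * v)\<^sup>2 / (s * t) \<ge> 0"
    using assms by simp
  ultimately show ?thesis by linarith
qed

section \<open>Jump energies under weights in detailed balance with the field\<close>

locale exchange_reversible =
  fixes \<Lambda> :: "'a set" and \<alpha> :: "'a \<Rightarrow> real" and S :: "('a \<Rightarrow> bool) set"
    and w :: "('a \<Rightarrow> bool) \<Rightarrow> real" and f :: "('a \<Rightarrow> bool) \<Rightarrow> real"
  assumes finite_S: "finite S"
    and exchange_S: "\<And>x y \<eta>. x \<in> \<Lambda> \<Longrightarrow> y \<in> \<Lambda> \<Longrightarrow> \<eta> \<in> S \<Longrightarrow> exchange x y \<eta> \<in> S"
    and w_nonneg: "\<And>\<eta>. w \<eta> \<ge> 0"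
    and w_exchange: "\<And>x y \<eta>. x \<in> \<Lambda> \<Longrightarrow> y \<in> \<Lambda> \<Longrightarrow> \<eta> x \<Longrightarrow> \<not> \<eta> y \<Longrightarrow>
      w (exchange x y \<eta>) = exp (\<alpha> y - \<alpha> x) * w \<eta>"
begin

definition grad :: "'a \<Rightarrow> 'a \<Rightarrow> ('a \<Rightarrow> bool) \<Rightarrow> real" where
  "grad x y \<eta> = f (exchange x y \<eta>) - f \<eta>"

text \<open>One direction only: each pair of distinct configurations linked by the exchange counts
  once, with the weight of the one whose particle is at \<open>x\<close>.\<close>

definition jump_energy :: "'a \<Rightarrow> 'a \<Rightarrow> real" where
  "jump_energy x y = (\<Sum>\<eta> | \<eta> \<in> S \<and> \<eta> x \<and> \<not> \<eta> y. w \<eta> * (grad x y \<eta>)\<^sup>2)"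

lemma jump_energy_nonneg: "jump_energy x y \<ge> 0"
  unfolding jump_energy_def by (intro sum_nonneg mult_nonneg_nonneg w_nonneg) auto

lemma sum_exchange:
  assumes "x \<in> \<Lambda>" "y \<in> \<Lambda>"
  shows "(\<Sum>\<eta> | \<eta> \<in> S \<and> P \<eta>. g (exchange x y \<eta>)) =
    (\<Sum>\<eta> | \<eta> \<in> S \<and> P (exchange x y \<eta>). g \<eta>)"
  by (rule sum.reindex_bij_witness[of _ "exchange x y" "exchange x y"])
    (auto intro: exchange_S[OF assms])

text \<open>The exchange maps jumps from \<open>x\<close> to \<open>y\<close> onto the reverse ones,
  keeping the squared gradient and multiplying the weight by the detailed balance factor.\<close>

lemma sum_grad_square_eq:
  assumes "x \<in> \<Lambda>" "y \<in> \<Lambda>"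
  shows "(\<Sum>\<eta>\<in>S. w \<eta> * (grad x y \<eta>)\<^sup>2) = (1 + exp (\<alpha> y - \<alpha> x)) * jump_energy x y"
proof -
  let ?g = "\<lambda>\<eta>. w \<eta> * (grad x y \<eta>)\<^sup>2"
  have trivial: "?g \<eta> = 0" if "\<eta> x = \<eta> y" for \<eta>
    using exchange_eq_self[of \<eta> x y] that by (simp add: grad_def)
  have "(\<Sum>\<eta>\<in>S. ?g \<eta>) = sum ?g ({\<eta>. \<eta> \<in> S \<and> \<eta> x \<and> \<not> \<eta> y} \<union> {\<eta>. \<eta> \<in> S \<and> \<not> \<eta> x \<and> \<eta> y})"
    using finite_S by (intro sum.mono_neutral_right) (use trivial in blast)+
  also have "\<dots> = jump_energy x y + (\<Sum>\<eta> | \<eta> \<in> S \<and> \<not> \<eta> x \<and> \<eta> y. ?g \<eta>)"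
    using finite_S unfolding jump_energy_def by (intro sum.union_disjoint) auto
  also have "(\<Sum>\<eta> | \<eta> \<in> S \<and> \<not> \<eta> x \<and> \<eta> y. ?g \<eta>) =
      (\<Sum>\<eta> | \<eta> \<in> S \<and> \<eta> x \<and> \<not> \<eta> y. ?g (exchange x y \<eta>))"
    by (subst sum_exchange[OF assms]) (auto intro!: sum.cong)
  also have "\<dots> = (\<Sum>\<eta> | \<eta> \<in> S \<and> \<eta> x \<and> \<not> \<eta> y. exp (\<alpha> y - \<alpha> x) * ?g \<eta>)"
    by (intro sum.cong refl) (auto simp: w_exchange[OF assms] grad_def power2_commute)
  also have "\<dots> = exp (\<alpha> y - \<alpha> x) * jump_energy x y"
    by (simp add: jump_energy_def sum_distrib_left)
  finally show ?thesis by (simp add: algebra_simps)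
qed

text \<open>With a particle at \<open>x\<close> and a hole at \<open>y\<close>,
  \<open>exp (- \<alpha> x) * w \<eta>\<close> is, by detailed balance, equal to
  \<open>exp (- \<alpha> y)\<close> times the weight after the jump. The form is therefore symmetric
  for sites in \<open>\<Lambda>\<close>.\<close>

definition tilted_energy :: "('a \<Rightarrow> real) \<Rightarrow> 'a \<Rightarrow> 'a \<Rightarrow> real" where
  "tilted_energy b x y = exp (b x + b y - \<alpha> x) * jump_energy x y"

text \<open>
  A particle at \<open>x\<close> reaches the hole at \<open>y\<close> by one jump along \<open>{x, m}\<close> and one along \<open>{m, y}\<close>; the
  order is dictated by \<open>\<eta> m\<close>. The four resulting classes of jumps are distinguished by the
  occupation of the third site, so no jump is used twice.
\<close>

lemma tilted_energy_split:
  assumes in_\<Lambda>: "x \<in> \<Lambda>" "m \<in> \<Lambda>" "y \<in> \<Lambda>"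
    and distinct: "x \<noteq> m" "m \<noteq> y" "x \<noteq> y"
    and b: "b x \<le> \<alpha> x" "b y \<le> \<alpha> y" "b m = \<alpha> m" "b x \<le> b m" "b y \<le> b m"
    and pos: "s > 0" "t > 0"
  shows "tilted_energy b x y \<le> (s + t) * (tilted_energy b x m / s + tilted_energy b m y / t)"
proof -
  define c where "c u v = exp (b u + b v - \<alpha> u)" for u v
  define h where "h u v \<eta> = c u v * (w \<eta> * (grad u v \<eta>)\<^sup>2)" for u v \<eta>
  have tilted: "tilted_energy b u v = (\<Sum>\<eta> | \<eta> \<in> S \<and> \<eta> u \<and> \<not> \<eta> v. h u v \<eta>)" for u v
    by (simp add: tilted_energy_def jump_energy_def h_def c_def sum_distrib_left)
  have tilted_split: "tilted_energy b u v =
      (\<Sum>\<eta> | \<eta> \<in> S \<and> \<eta> u \<and> \<not> \<eta> v \<and> \<not> \<eta> z. h u v \<eta>) + (\<Sum>\<eta> | \<eta> \<in> S \<and> \<eta> u \<and> \<not> \<eta> v \<and> \<eta> z. h u v \<eta>)"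
    for u v z
    unfolding tilted using finite_S
    by (subst sum.union_disjoint[symmetric]) (auto intro!: sum.cong)

  \<comment> \<open>It remains to show, for each of the two jumps of a path separately, that its
    tilted weight dominates \<open>c x y * w \<eta>\<close>.\<close>
  have combine: "c x y * (w \<eta> * (p + q)\<^sup>2) \<le> (s + t) * (A / s + B / t)"
    if "c x y * w \<eta> * p\<^sup>2 \<le> A" "c x y * w \<eta> * q\<^sup>2 \<le> B" for \<eta> p q A B
  proof -
    have "c x y * (w \<eta> * (p + q)\<^sup>2) \<le> c x y * w \<eta> * ((s + t) * (p\<^sup>2 / s + q\<^sup>2 / t))"
      using square_add_le_weighted[OF pos, of p q]
      by (simp add: c_def w_nonneg mult.assoc mult_left_mono)
    also have "\<dots> = (s + t) * (c x y * w \<eta> * p\<^sup>2 / s + c x y * w \<eta> * q\<^sup>2 / t)"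
      by (simp add: algebra_simps)
    also have "\<dots> \<le> (s + t) * (A / s + B / t)"
      using pos that by (intro mult_left_mono add_mono divide_right_mono) auto
    finally show ?thesis .
  qed

  have empty: "h x y \<eta> \<le> (s + t) * (h x m \<eta> / s + h m y (exchange x m \<eta>) / t)"
    if \<eta>: "\<eta> x" "\<not> \<eta> y" "\<not> \<eta> m" for \<eta>
  proof -
    have path: "exchange m y (exchange x m \<eta>) = exchange x y \<eta>"
      using \<eta> distinct by (auto simp: exchange_def fun_eq_iff)
    have "grad x y \<eta> = grad x m \<eta> + grad m y (exchange x m \<eta>)"
      unfolding grad_def path by simp
    \<comment> \<open>\<open>c x y \<le> c x m\<close> because \<open>b y \<le> b m\<close>.\<close>
    moreover have "c x y * w \<eta> * (grad x m \<eta>)\<^sup>2 \<le> h x m \<eta>"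
      using b by (auto simp: h_def c_def mult.assoc intro!: mult_right_mono mult_nonneg_nonneg w_nonneg)
    \<comment> \<open>Detailed balance turns the factor \<open>exp (- \<alpha> m)\<close> of
      \<open>c m y\<close> into \<open>exp (- \<alpha> x)\<close>, so \<open>b x \<le> b m\<close>
      suffices.\<close>
    moreover have "c x y * w \<eta> \<le> c m y * w (exchange x m \<eta>)"
      using b by (simp add: w_exchange in_\<Lambda> \<eta> c_def mult.assoc[symmetric] w_nonneg mult_right_mono
          flip: exp_add)
    then have "c x y * w \<eta> * (grad m y (exchange x m \<eta>))\<^sup>2 \<le> h m y (exchange x m \<eta>)"
      by (simp add: h_def mult.assoc[symmetric] mult_right_mono)
    ultimately show ?thesis
      using combine by (simp add: h_def)
  qed

  have occupied: "h x y \<eta> \<le> (s + t) * (h x m (exchange m y \<eta>) / s + h m y \<eta> / t)"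
    if \<eta>: "\<eta> x" "\<not> \<eta> y" "\<eta> m" for \<eta>
  proof -
    have path: "exchange x m (exchange m y \<eta>) = exchange x y \<eta>"
      using \<eta> distinct by (auto simp: exchange_def fun_eq_iff)
    have "grad x y \<eta> = grad x m (exchange m y \<eta>) + grad m y \<eta>"
      unfolding grad_def path by simp
    \<comment> \<open>As \<open>b m = \<alpha> m\<close>, \<open>c m y\<close> is just
      \<open>exp (b y)\<close>; now \<open>b x \<le> \<alpha> x\<close> is what matters.\<close>
    moreover have "c x y * w \<eta> * (grad m y \<eta>)\<^sup>2 \<le> h m y \<eta>"
      using b by (auto simp: h_def c_def mult.assoc intro!: mult_right_mono mult_nonneg_nonneg w_nonneg)
    \<comment> \<open>\<open>b m\<close> cancels against \<open>\<alpha> m\<close>, leaving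
      \<open>b y \<le> \<alpha> y\<close>.\<close>
    moreover have "c x y * w \<eta> \<le> c x m * w (exchange m y \<eta>)"
      using b by (simp add: w_exchange in_\<Lambda> \<eta> c_def mult.assoc[symmetric] w_nonneg mult_right_mono
          flip: exp_add)
    then have "c x y * w \<eta> * (grad x m (exchange m y \<eta>))\<^sup>2 \<le> h x m (exchange m y \<eta>)"
      by (simp add: h_def mult.assoc[symmetric] mult_right_mono)
    ultimately show ?thesis
      using combine by (simp add: h_def)
  qed

  have "tilted_energy b x y \<le>
      (\<Sum>\<eta> | \<eta> \<in> S \<and> \<eta> x \<and> \<not> \<eta> y \<and> \<not> \<eta> m. (s + t) * (h x m \<eta> / s + h m y (exchange x m \<eta>) / t)) +
      (\<Sum>\<eta> | \<eta> \<in> S \<and> \<eta> x \<and> \<not> \<eta> y \<and> \<eta> m. (s + t) * (h x m (exchange m y \<eta>) / s + h m y \<eta> / t))"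
    unfolding tilted_split[of x y m] by (intro add_mono sum_mono) (auto intro: empty occupied)
  also have "\<dots> = (s + t) *
     (((\<Sum>\<eta> | \<eta> \<in> S \<and> \<eta> x \<and> \<not> \<eta> y \<and> \<not> \<eta> m. h x m \<eta>) +
       (\<Sum>\<eta> | \<eta> \<in> S \<and> \<eta> x \<and> \<not> \<eta> y \<and> \<eta> m. h x m (exchange m y \<eta>))) / s +
      ((\<Sum>\<eta> | \<eta> \<in> S \<and> \<eta> x \<and> \<not> \<eta> y \<and> \<not> \<eta> m. h m y (exchange x m \<eta>)) +
       (\<Sum>\<eta> | \<eta> \<in> S \<and> \<eta> x \<and> \<not> \<eta> y \<and> \<eta> m. h m y \<eta>)) / t)"
    by (simp add: sum_distrib_left[symmetric] sum.distrib sum_divide_distrib[symmetric]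
        distrib_left[symmetric] add_divide_distrib)
  \<comment> \<open>These become the jumps from \<open>x\<close> to \<open>m\<close> with
    \<open>y\<close> occupied; the other sum already has those with \<open>y\<close> empty.\<close>
  also have "(\<Sum>\<eta> | \<eta> \<in> S \<and> \<eta> x \<and> \<not> \<eta> y \<and> \<eta> m. h x m (exchange m y \<eta>)) =
      (\<Sum>\<eta> | \<eta> \<in> S \<and> \<eta> x \<and> \<not> \<eta> m \<and> \<eta> y. h x m \<eta>)"
    by (subst sum_exchange) (use in_\<Lambda> distinct in \<open>auto intro!: sum.cong\<close>)
  also have "(\<Sum>\<eta> | \<eta> \<in> S \<and> \<eta> x \<and> \<not> \<eta> y \<and> \<not> \<eta> m. h m y (exchange x m \<eta>)) =
      (\<Sum>\<eta> | \<eta> \<in> S \<and> \<eta> m \<and> \<not> \<eta> y \<and> \<not> \<eta> x. h m y \<eta>)"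
    by (subst sum_exchange) (use in_\<Lambda> distinct in \<open>auto intro!: sum.cong\<close>)
  also have "(\<Sum>\<eta> | \<eta> \<in> S \<and> \<eta> x \<and> \<not> \<eta> y \<and> \<not> \<eta> m. h x m \<eta>) +
      (\<Sum>\<eta> | \<eta> \<in> S \<and> \<eta> x \<and> \<not> \<eta> m \<and> \<eta> y. h x m \<eta>) = tilted_energy b x m"
    unfolding tilted_split[of x m y] by (simp add: conj_ac)
  also have "(\<Sum>\<eta> | \<eta> \<in> S \<and> \<eta> m \<and> \<not> \<eta> y \<and> \<not> \<eta> x. h m y \<eta>) +
      (\<Sum>\<eta> | \<eta> \<in> S \<and> \<eta> x \<and> \<not> \<eta> y \<and> \<eta> m. h m y \<eta>) = tilted_energy b m y"
    unfolding tilted_split[of m y x] by (simp add: conj_ac)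
  finally show ?thesis .
qed

text \<open>Strong induction on the length, cutting at an interior minimum \<open>m\<close> of
  \<open>b\<close>. As an endpoint of both halves, \<open>m\<close> again lies below all their
  interior sites, so the series law applies anew.\<close>

lemma tilted_energy_le_sum_path:
  fixes p :: "int \<Rightarrow> 'a"
  assumes "x < y" "inj_on p {x..y}" "p ` {x..y} \<subseteq> \<Lambda>"
    and "b (p x) \<le> \<alpha> (p x)" "b (p y) \<le> \<alpha> (p y)"
    and "\<And>z. x < z \<Longrightarrow> z < y \<Longrightarrow> b (p z) = \<alpha> (p z) \<and> b (p x) \<le> b (p z) \<and> b (p y) \<le> b (p z)"
  shows "tilted_energy b (p x) (p y) \<le>
    of_int (y - x) * (\<Sum>z=x..y-1. tilted_energy b (p z) (p (z + 1)))"
  using assms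
proof (induction "nat (y - x)" arbitrary: x y rule: less_induct)
  case less
  show ?case
  proof (cases "y = x + 1")
    case True
    then show ?thesis by simp
  next
    case False
    with \<open>x < y\<close> have "x + 1 \<in> {x<..<y}" by auto
    then have "{x<..<y} \<noteq> {}" by blast
    then obtain m where m: "m \<in> {x<..<y}"
        and min: "\<And>z. z \<in> {x<..<y} \<Longrightarrow> b (p m) \<le> b (p z)"
      using ex_is_arg_min_if_finite[of "{x<..<y}" "\<lambda>z. b (p z)"]
      by (auto simp: is_arg_min_linorder)
    let ?g = "\<lambda>z. tilted_energy b (p z) (p (z + 1))"
    let ?P = "\<Sum>z=x..m-1. ?g z" and ?Q = "\<Sum>z=m..y-1. ?g z"
    have left: "tilted_energy b (p x) (p m) \<le> of_int (m - x) * ?P"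
    proof (rule less.hyps)
      show "b (p z) = \<alpha> (p z) \<and> b (p x) \<le> b (p z) \<and> b (p m) \<le> b (p z)" if "x < z" "z < m" for z
        using less.prems(6)[of z] less.prems(6)[of m] min[of z] m that by auto
    qed (use less.prems m in \<open>auto intro: inj_on_subset\<close>)
    have right: "tilted_energy b (p m) (p y) \<le> of_int (y - m) * ?Q"
    proof (rule less.hyps)
      show "b (p z) = \<alpha> (p z) \<and> b (p m) \<le> b (p z) \<and> b (p y) \<le> b (p z)" if "m < z" "z < y" for z
        using less.prems(6)[of z] less.prems(6)[of m] min[of z] m that by auto
    qed (use less.prems m in \<open>auto intro: inj_on_subset\<close>)
    have ne: "p x \<noteq> p m" "p m \<noteq> p y" "p x \<noteq> p y"
      using m by (auto simp: inj_on_eq_iff[OF less.prems(2)])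
    \<comment> \<open>Taking the lengths as weights cancels the length factors of
      \<open>left\<close> and \<open>right\<close>, so the constant grows only linearly.\<close>
    have "tilted_energy b (p x) (p y) \<le> (of_int (m - x) + of_int (y - m)) *
        (tilted_energy b (p x) (p m) / of_int (m - x) + tilted_energy b (p m) (p y) / of_int (y - m))"
      by (rule tilted_energy_split) (use less.prems(1-5) less.prems(6)[of m] m ne in auto)
    also have "\<dots> \<le> (of_int (m - x) + of_int (y - m)) * (?P + ?Q)"
      using m left right by (intro mult_left_mono add_mono) (auto simp: field_simps)
    also have "?P + ?Q = (\<Sum>z=x..y-1. ?g z)"
      using m by (subst sum.union_disjoint[symmetric]) (auto intro!: sum.cong)
    finally show ?thesis by simp
  qed
qed

end

section \<open>Detailed balance for the conditioned Bernoulli measure\<close>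

lemma particle_number_exchange:
  assumes "x \<in> \<Lambda>" "y \<in> \<Lambda>"
  shows "particle_number \<Lambda> (exchange x y \<eta>) = particle_number \<Lambda> \<eta>"
  unfolding particle_number_def
  by (rule sum.reindex_bij_witness[of _ "Transposition.transpose x y" "Transposition.transpose x y"])
    (use assms in \<open>auto simp: exchange_eq_comp_transpose Transposition.transpose_def\<close>)

text \<open>Only the factors at \<open>x\<close> and \<open>y\<close> change, and at each site the
  odds of being occupied are \<open>exp (\<alpha> z)\<close>. If \<open>\<eta>\<close> has a
  particle outside \<open>\<Lambda>\<close>, so does its exchange, and both sides vanish.\<close>

lemma pmf_inhom_bernoulli_exchange:
  assumes "finite \<Lambda>" "x \<in> \<Lambda>" "y \<in> \<Lambda>" "\<eta> x" "\<not> \<eta> y"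
  shows "pmf (inhom_bernoulli \<alpha> \<Lambda>) (exchange x y \<eta>) =
    exp (\<alpha> y - \<alpha> x) * pmf (inhom_bernoulli \<alpha> \<Lambda>) \<eta>"
proof (cases "\<forall>z. z \<notin> \<Lambda> \<longrightarrow> \<not> \<eta> z")
  case True
  define q where "q z b = density (\<alpha> z) ^ of_bool b * (1 - density (\<alpha> z)) ^ (1 - of_bool b)"
    for z b
  have "x \<noteq> y" using assms by auto
  have rest: "(\<Prod>z\<in>\<Lambda> - {x} - {y}. q z (exchange x y \<eta> z)) = (\<Prod>z\<in>\<Lambda> - {x} - {y}. q z (\<eta> z))"
    by (intro prod.cong) auto
  have split: "(\<Prod>z\<in>\<Lambda>. q z (\<zeta> z)) = q x (\<zeta> x) * (q y (\<zeta> y) * (\<Prod>z\<in>\<Lambda> - {x} - {y}. q z (\<zeta> z)))" for \<zeta>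
    using assms \<open>x \<noteq> y\<close> by (simp add: prod.remove[of _ x] prod.remove[of _ y])
  have ratio: "q z True = exp (\<alpha> z) * q z False" for z
    using exp_gt_zero[of "\<alpha> z"] by (simp add: q_def density_def field_simps add_pos_pos
      less_imp_neq[THEN not_sym])
  have support: "\<not> exchange x y \<eta> z" if "z \<notin> \<Lambda>" for z
    using True that assms by (auto simp: exchange_def)
  have "pmf (inhom_bernoulli \<alpha> \<Lambda>) (exchange x y \<eta>) = (\<Prod>z\<in>\<Lambda>. q z (exchange x y \<eta> z))"
    using support by (subst pmf_inhom_bernoulli) (auto simp: assms q_def)
  moreover have "pmf (inhom_bernoulli \<alpha> \<Lambda>) \<eta> = (\<Prod>z\<in>\<Lambda>. q z (\<eta> z))"
    using True by (subst pmf_inhom_bernoulli) (auto simp: assms q_def)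
  ultimately show ?thesis
    using assms by (simp add: split rest ratio exp_diff)
next
  case False
  then obtain z where z: "z \<notin> \<Lambda>" "\<eta> z" by blast
  then have "exchange x y \<eta> z"
    using assms by (auto simp: exchange_def)
  with z assms show ?thesis
    by (metis (mono_tags, lifting) mem_Collect_eq mult_zero_right pmf_eq_0_set_pmf set_pmf_inhom_bernoulli)
qed

lemma finite_set_pmf_inhom_bernoulli:
  assumes "finite \<Lambda>"
  shows "finite (set_pmf (inhom_bernoulli \<alpha> \<Lambda>))"
proof (rule finite_subset)
  show "set_pmf (inhom_bernoulli \<alpha> \<Lambda>) \<subseteq> (\<lambda>A z. z \<in> A) ` Pow \<Lambda>"
  proof
    fix \<eta> assume "\<eta> \<in> set_pmf (inhom_bernoulli \<alpha> \<Lambda>)"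
    then have "{z. \<eta> z} \<in> Pow \<Lambda>"
      using assms by (auto simp: set_pmf_inhom_bernoulli)
    then show "\<eta> \<in> (\<lambda>A z. z \<in> A) ` Pow \<Lambda>"
      by (intro image_eqI[of _ _ "{z. \<eta> z}"]) auto
  qed
qed (use assms in simp)

text \<open>Exchanges preserve the particle number, so conditioning divides both sides of detailed
  balance by the same constant.\<close>

lemma exchange_reversible_cond_bernoulli:
  assumes "finite \<Lambda>" "N \<le> card \<Lambda>"
  shows "exchange_reversible \<Lambda> \<alpha> (set_pmf (cond_bernoulli \<alpha> \<Lambda> N)) (pmf (cond_bernoulli \<alpha> \<Lambda> N))"
proof
  note possible = inhom_bernoulli_particle_number_possible[OF assms, of \<alpha>]
  have set_eq: "set_pmf (cond_bernoulli \<alpha> \<Lambda> N) =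
      set_pmf (inhom_bernoulli \<alpha> \<Lambda>) \<inter> {\<eta>. particle_number \<Lambda> \<eta> = N}"
    unfolding cond_bernoulli_def by (rule set_cond_pmf[OF possible])
  show "finite (set_pmf (cond_bernoulli \<alpha> \<Lambda> N))"
    using finite_set_pmf_inhom_bernoulli[OF assms(1)] by (simp add: set_eq)
  show "exchange x y \<eta> \<in> set_pmf (cond_bernoulli \<alpha> \<Lambda> N)"
    if "x \<in> \<Lambda>" "y \<in> \<Lambda>" "\<eta> \<in> set_pmf (cond_bernoulli \<alpha> \<Lambda> N)" for x y \<eta>
    using that assms by (auto simp: set_eq particle_number_exchange set_pmf_inhom_bernoulli)
      (metis exchange_simps)
  show "pmf (cond_bernoulli \<alpha> \<Lambda> N) (exchange x y \<eta>) =
      exp (\<alpha> y - \<alpha> x) * pmf (cond_bernoulli \<alpha> \<Lambda> N) \<eta>"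
    if "x \<in> \<Lambda>" "y \<in> \<Lambda>" "\<eta> x" "\<not> \<eta> y" for x y \<eta>
    using that assms unfolding cond_bernoulli_def
    by (simp add: pmf_cond[OF possible] particle_number_exchange pmf_inhom_bernoulli_exchange)
qed simp

section \<open>Comparison of tilted and true rates\<close>

theorem lemma1:
  fixes K :: real and L :: int and \<Lambda> :: "int set" and \<alpha> :: "int \<Rightarrow> real" and N :: nat
    and f :: "(int \<Rightarrow> bool) \<Rightarrow> real"
  assumes "K \<ge> 0" and "L \<ge> 2" and "finite \<Lambda>" and "{1..L} \<subseteq> \<Lambda>"
    and "\<And>x. x \<in> \<Lambda> \<Longrightarrow> \<alpha> x \<in> {-K..K}"
    and "N \<le> card \<Lambda>"
  defines "\<mu> \<equiv> cond_bernoulli \<alpha> \<Lambda> N"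
  shows "measure_pmf.expectation \<mu> (\<lambda>\<eta>. (f (exchange 1 L \<eta>) - f \<eta>)\<^sup>2)
    \<le> exp (13 * K) * of_int L *
      (\<Sum>x=1..L-1. measure_pmf.expectation \<mu> (\<lambda>\<eta>. (f (exchange x (x + 1) \<eta>) - f \<eta>)\<^sup>2))"
proof -
  interpret exchange_reversible \<Lambda> \<alpha> "set_pmf \<mu>" "pmf \<mu>" f
    unfolding \<mu>_def by (rule exchange_reversible_cond_bernoulli) fact+
  define D where "D x y = measure_pmf.expectation \<mu> (\<lambda>\<eta>. (f (exchange x y \<eta>) - f \<eta>)\<^sup>2)" for x y
  have D_eq: "D x y = (1 + exp (\<alpha> y - \<alpha> x)) * jump_energy x y" if "x \<in> \<Lambda>" "y \<in> \<Lambda>" for x y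
    unfolding sum_grad_square_eq[OF that, symmetric] D_def
    by (subst integral_measure_pmf_real[OF finite_S]) (auto simp: grad_def mult.commute)
  have D_nonneg: "D x y \<ge> 0" for x y
    by (simp add: D_def)
  define b where "b z = (if z = 1 \<or> z = L then - K else \<alpha> z)" for z
  have \<alpha>: "- K \<le> \<alpha> z" "\<alpha> z \<le> K" if "z \<in> {1..L}" for z
    using assms that by (auto dest!: subsetD[OF assms(4)] assms(5))
  have b_le: "b z \<le> \<alpha> z" if "z \<in> {1..L}" for z
    using \<alpha>[OF that] by (simp add: b_def)
  have neighbour: "2 * exp (- K) * tilted_energy b z (z + 1) \<le> D z (z + 1)" if z: "z \<in> {1..L-1}" for z
  proof -
    \<comment> \<open>The tilted rate is compared with each of the two terms of
      \<open>1 + exp (\<alpha> (z + 1) - \<alpha> z)\<close>; using \<open>b \<le> \<alpha>\<close>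
      at both sites, a single bound \<open>\<alpha> \<le> K\<close> is spent, hence
      \<open>exp K\<close>.\<close>
    have "exp (- K + (b z + b (z + 1) - \<alpha> z)) \<le> exp 0"
      unfolding exp_le_cancel_iff using b_le[of z] b_le[of "z + 1"] \<alpha>[of "z + 1"] z by auto
    moreover have "exp (- K + (b z + b (z + 1) - \<alpha> z)) \<le> exp (\<alpha> (z + 1) - \<alpha> z)"
      unfolding exp_le_cancel_iff using b_le[of z] b_le[of "z + 1"] \<alpha>[of z] z by auto
    ultimately have "2 * (exp (- K) * exp (b z + b (z + 1) - \<alpha> z)) \<le> 1 + exp (\<alpha> (z + 1) - \<alpha> z)"
      unfolding exp_add[symmetric] exp_zero by linarith
    then have "2 * (exp (- K) * exp (b z + b (z + 1) - \<alpha> z)) * jump_energy z (z + 1) \<le> D z (z + 1)"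
      using z assms(4) by (subst D_eq) (auto intro!: mult_right_mono jump_energy_nonneg)
    then show ?thesis
      by (simp add: tilted_energy_def mult.assoc)
  qed
  have ends: "D 1 L \<le> 2 * exp (3 * K) * tilted_energy b 1 L"
  proof -
    \<comment> \<open>\<open>b 1 + b L\<close> is \<open>- 2 * K\<close>, so the exponent is
      \<open>K - \<alpha> 1\<close>, which dominates both \<open>0\<close> and
      \<open>\<alpha> L - \<alpha> 1\<close>.\<close>
    have "exp 0 \<le> exp (3 * K + (b 1 + b L - \<alpha> 1))"
      unfolding exp_le_cancel_iff using \<alpha>[of 1] assms(2) by (simp add: b_def)
    moreover have "exp (\<alpha> L - \<alpha> 1) \<le> exp (3 * K + (b 1 + b L - \<alpha> 1))"
      unfolding exp_le_cancel_iff using \<alpha>[of L] assms(2) by (simp add: b_def)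
    ultimately have "1 + exp (\<alpha> L - \<alpha> 1) \<le> 2 * (exp (3 * K) * exp (b 1 + b L - \<alpha> 1))"
      unfolding exp_add[symmetric] exp_zero by linarith
    then have "D 1 L \<le> 2 * (exp (3 * K) * exp (b 1 + b L - \<alpha> 1)) * jump_energy 1 L"
      using assms(2,4) by (subst D_eq) (auto intro!: mult_right_mono jump_energy_nonneg)
    then show ?thesis
      by (simp add: tilted_energy_def mult.assoc)
  qed
  have "tilted_energy b 1 L \<le> of_int (L - 1) * (\<Sum>z=1..L-1. tilted_energy b z (z + 1))"
    using tilted_energy_le_sum_path[of 1 L "\<lambda>z. z" b] assms(2,4) \<alpha> b_le
    by (auto simp: b_def)
  also have "\<dots> \<le> of_int L * (\<Sum>z=1..L-1. exp K / 2 * D z (z + 1))"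
  proof (rule mult_mono)
    show "(\<Sum>z=1..L-1. tilted_energy b z (z + 1)) \<le> (\<Sum>z=1..L-1. exp K / 2 * D z (z + 1))"
      using neighbour by (intro sum_mono) (simp add: exp_minus field_simps)
    show "(\<Sum>z=1..L-1. tilted_energy b z (z + 1)) \<ge> 0"
      by (intro sum_nonneg) (simp add: tilted_energy_def jump_energy_nonneg)
  qed (use assms(2) in auto)
  also have "\<dots> = exp K / 2 * of_int L * (\<Sum>z=1..L-1. D z (z + 1))"
    by (simp only: sum_distrib_left[symmetric] mult.assoc mult.left_commute[of "exp K / 2"])
  finally have "2 * exp (3 * K) * tilted_energy b 1 L \<le>
      2 * exp (3 * K) * (exp K / 2 * of_int L * (\<Sum>z=1..L-1. D z (z + 1)))"
    by simp
  also have "\<dots> = exp (3 * K + K) * of_int L * (\<Sum>z=1..L-1. D z (z + 1))"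
    unfolding exp_add by simp
  \<comment> \<open>The ends cost \<open>exp (3 * K)\<close> and the neighbours
    \<open>exp K\<close>; \<open>K \<ge> 0\<close> absorbs the product into the stated
    constant.\<close>
  also have "\<dots> \<le> exp (13 * K) * of_int L * (\<Sum>z=1..L-1. D z (z + 1))"
    using assms(1,2) by (intro mult_right_mono sum_nonneg D_nonneg) auto
  finally show ?thesis
    using ends unfolding D_def by linarith
qed

end
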